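(* Let $T>0$, $\eta>0$, $\bar\varepsilon>0$, $n\in\mathbb{N}$, $\mu\ge 0$, $\mu_1,\dots,\mu_n\ge 0$ and $\tau_1,\dots,\tau_n>0$. Let $\varepsilon$ be the strain on $[0,T]$ given by $\varepsilon(t)=\eta t$ for $0\le t\le\bar\varepsilon/\eta$ and $\varepsilon(t)=\bar\varepsilon$ for $\bar\varepsilon/\eta<t\le T$. Then the following hold for $t\in[0,T]$. (1) For $j\in\{1,\dots,n\}$, the stress $\sigma_j$ of the $j$-th Maxwell element with stiffness $\mu_j$ and relaxation time $\tau_j$ is $$\sigma_j(t)=\begin{cases}\dfrac{\mu_j\tau_j\eta}{2}\left(1-\exp\!\left(-\dfrac{2}{\tau_j}t\right)\right), & 0\le t\le\dfrac{\bar\varepsilon}{\eta},\\[2ex] -\dfrac{\mu_j\tau_j\eta}{2}\left(1-\exp\!\left(\dfrac{2\bar\varepsilon}{\tau_j\eta}\right)\right)\exp\!\left(-\dfrac{2}{\tau_j}t\right), & \dfrac{\bar\varepsilon}{\eta}<t\le T.\end{cases}$$ (2) The stress $\sigma_0$ of the single spring with stiffness $\mu$ is $$\sigma_0(t)=\begin{cases}\mu\eta t, & 0\le t\le\dfrac{\bar\varepsilon}{\eta},\\[1ex] \mu\bar\varepsilon, & \dfrac{\bar\varepsilon}{\eta}<t\le T.\end{cases}$$ (3) The total stress is the sum of the stresses of the single spring and the Maxwell elements, i.e. $$\sigma(t)=\sum_{j=0}^n\sigma_j(t)=\begin{cases}\mu\eta t+\displaystyle\sum_{j=1}^n\dfrac{\mu_j\tau_j\eta}{2}\left(1-\exp\!\left(-\dfrac{2}{\tau_j}t\right)\right),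 & 0\le t\le\dfrac{\bar\varepsilon}{\eta},\\[2ex] \mu\bar\varepsilon-\displaystyle\sum_{j=1}^n\dfrac{\mu_j\tau_j\eta}{2}\left(1-\exp\!\left(\dfrac{2\bar\varepsilon}{\tau_j\eta}\right)\right)\exp\!\left(-\dfrac{2}{\tau_j}t\right), & \dfrac{\bar\varepsilon}{\eta}<t\le T.\end{cases}$$
   Context: The rheological model is a parallel combination of a single spring with stiffness $\mu$ and $n$ Maxwell elements, the $j$-th having spring stiffness $\mu_j$ and damper relaxation time $\tau_j$. Here $\eta$ is the displacement rate, $\bar\varepsilon$ the maximum strain and $[0,T]$ the time interval of the experiment. The superscript $i$ in $\varepsilon_j^i$ stands for "inelastic" and is not an exponent or index. The inelastic strain $\varepsilon_j^i$ of the $j$-th Maxwell element satisfies the evolution equation $$\dot\varepsilon_j^{\,i}(t)=\frac{\varepsilon(t)-\varepsilon_j^{\,i}(t)}{\tau_j/2},$$ where the dot denotes the time derivative, and it is the solution of this equation given by $$\varepsilon_j^i(t)=\int_0^t \varepsilon(\tilde t)\,\frac{2}{\tau_j}\exp\!\left(-2\,\frac{t-\tilde t}{\tau_j}\right)d\tilde t ,$$ i.e. the solution with $\varepsilon_j^i(0)=0$. The stress of the single spring is $\sigma_0(t)=\mu\,\varepsilon(t)$, the stress of the $j$-th Maxwell element ($1\le j\le n$) is $\sigma_j(t)=\mu_j\big(\varepsilon(t)-\varepsilon_j^{\,i}(t)\big)$, and the total stress is $$\sigma(t)=\mu\,\varepsilon(t)+\sum_{j=1}^n\mu_j\big(\varepsilon(t)-\varepsilon_j^{\,i}(t)\big).$$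 *)

theory Defs
  imports "HOL-Analysis.Analysis"
begin

definition inelastic_strain :: "real \<Rightarrow> (real \<Rightarrow> real) \<Rightarrow> real \<Rightarrow> real" where
  "inelastic_strain \<tau> \<epsilon> t =
     integral {0..t} (\<lambda>s. \<epsilon> s * (2 / \<tau>) * exp (- 2 * ((t - s) / \<tau>)))"

text \<open>For a continuous strain, the integral formula yields the solution of the evolution equation
  with zero initial value on \<open>{0..T}\<close>, and the only one (derivatives at the end points are
  one-sided).\<close>

lemma inelastic_strain_0: "inelastic_strain \<tau> \<epsilon> 0 = 0"
  by (simp add: inelastic_strain_def)

lemma inelastic_strain_evolution:
  assumes cont: "continuous_on {0..T} \<epsilon>" and \<tau>: "\<tau> > 0" and t: "t \<in> {0..T}"
  shows "(inelastic_strain \<tau> \<epsilon> has_real_derivative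
           (\<epsilon> t - inelastic_strain \<tau> \<epsilon> t) / (\<tau> / 2)) (at t within {0..T})"
proof -
  define g where "g = (\<lambda>s. \<epsilon> s * (2 / \<tau>) * exp (2 * s / \<tau>))"
  have eq: "inelastic_strain \<tau> \<epsilon> = (\<lambda>u. exp (- 2 * u / \<tau>) * integral {0..u} g)"
  proof
    fix u
    have "(\<lambda>s. \<epsilon> s * (2 / \<tau>) * exp (- 2 * ((u - s) / \<tau>))) = (\<lambda>s. exp (- 2 * u / \<tau>) * g s)"
      by (rule ext) (simp add: g_def exp_add[symmetric] diff_divide_distrib algebra_simps
          flip: exp_diff)
    then show "inelastic_strain \<tau> \<epsilon> u = exp (- 2 * u / \<tau>) * integral {0..u} g"
      by (simp add: inelastic_strain_def)
  qed
  have "continuous_on {0..T} g"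
    unfolding g_def using \<tau> by (intro continuous_intros cont) auto
  then have "((\<lambda>u. integral {0..u} g) has_real_derivative g t) (at t within {0..T})"
    using t by (rule integral_has_real_derivative)
  then have "((\<lambda>u. exp (- 2 * u / \<tau>) * integral {0..u} g) has_real_derivative
      exp (- 2 * t / \<tau>) * g t + (exp (- 2 * t / \<tau>) * (- 2 / \<tau>)) * integral {0..t} g)
      (at t within {0..T})"
    using \<tau> by (auto intro!: derivative_eq_intros)
  moreover have "exp (- 2 * t / \<tau>) * g t = \<epsilon> t * (2 / \<tau>)"
    by (simp add: g_def exp_minus field_simps)
  ultimately show ?thesis
    unfolding eq by (simp add: algebra_simps diff_divide_distrib)
qed

lemma inelastic_strain_unique:
  assumes cont: "continuous_on {0..T} \<epsilon>" and \<tau>: "\<tau> > 0"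
    and ode: "\<And>t. t \<in> {0..T} \<Longrightarrow>
      (y has_real_derivative (\<epsilon> t - y t) / (\<tau> / 2)) (at t within {0..T})"
    and init: "y 0 = 0" and t: "t \<in> {0..T}"
  shows "y t = inelastic_strain \<tau> \<epsilon> t"
proof -
  define d where "d = (\<lambda>s. exp (2 * s / \<tau>) * (y s - inelastic_strain \<tau> \<epsilon> s))"
  have "(d has_real_derivative 0) (at s within {0..T})" if s: "s \<in> {0..T}" for s
    unfolding d_def using \<tau>
    by (auto intro!: derivative_eq_intros ode[OF s] inelastic_strain_evolution[OF cont \<tau> s]
        simp: field_simps)
  then obtain c where "\<And>s. s \<in> {0..T} \<Longrightarrow> d s = c"
    using has_field_derivative_zero_constant[of "{0..T}" d] by auto
  then have "d t = d 0"
    using t by auto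
  then show ?thesis
    by (simp add: d_def init inelastic_strain_0)
qed

definition spring_stress :: "real \<Rightarrow> (real \<Rightarrow> real) \<Rightarrow> real \<Rightarrow> real" where
  "spring_stress \<mu> \<epsilon> t = \<mu> * \<epsilon> t"

definition maxwell_stress :: "real \<Rightarrow> real \<Rightarrow> (real \<Rightarrow> real) \<Rightarrow> real \<Rightarrow> real" where
  "maxwell_stress m \<tau> \<epsilon> t = m * (\<epsilon> t - inelastic_strain \<tau> \<epsilon> t)"

text \<open>Branch \<open>0\<close> of the parallel model is the single spring; the values \<open>m 0\<close> and \<open>\<tau> 0\<close> are
  never used.\<close>

definition branch_stress ::
  "real \<Rightarrow> (nat \<Rightarrow> real) \<Rightarrow> (nat \<Rightarrow> real) \<Rightarrow> (real \<Rightarrow> real) \<Rightarrow> nat \<Rightarrow> real \<Rightarrow> real" where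
  "branch_stress \<mu> m \<tau> \<epsilon> j t =
     (if j = 0 then spring_stress \<mu> \<epsilon> t else maxwell_stress (m j) (\<tau> j) \<epsilon> t)"

definition total_stress ::
  "nat \<Rightarrow> real \<Rightarrow> (nat \<Rightarrow> real) \<Rightarrow> (nat \<Rightarrow> real) \<Rightarrow> (real \<Rightarrow> real) \<Rightarrow> real \<Rightarrow> real" where
  "total_stress n \<mu> m \<tau> \<epsilon> t =
     \<mu> * \<epsilon> t + (\<Sum>j = 1..n. m j * (\<epsilon> t - inelastic_strain (\<tau> j) \<epsilon> t))"

end

theory Submission
  imports Defs
begin

text \<open>The inelastic strain is a convolution of the strain with an exponential kernel, and the
  prescribed strain is affine on each of the two phases of the experiment: the ramp
  \<open>\<eta> * s\<close> up to the time \<open>eps_max / \<eta>\<close>, then the constant \<open>eps_max\<close>. An affine function times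
  the kernel has an elementary antiderivative (lemma \<open>affine_kernel_integral\<close>). One application
  of it settles the ramp; in the hold phase the integral is cut at \<open>eps_max / \<eta>\<close>, and the two
  boundary terms at that point cancel up to a multiple of the jump \<open>\<eta>\<close> of the strain rate,
  because the strain itself is continuous there. This gives the Maxwell stresses; the spring and
  the sums follow from the definitions.\<close>

text \<open>The antiderivative comes from integration by parts: the kernel integrates to the exponential
  itself, and the constant slope \<open>d\<close> leaves the correction \<open>- d * \<tau> / 2\<close>.\<close>

lemma affine_kernel_integral:
  fixes a b c d t \<tau> :: real
  assumes \<tau>: "\<tau> > 0" and ab: "a \<le> b"
  shows "((\<lambda>s. (c + d * s) * (2 / \<tau>) * exp (- 2 * ((t - s) / \<tau>))) has_integral
     (c + d * b - d * \<tau> / 2) * exp (- 2 * ((t - b) / \<tau>))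
     - (c + d * a - d * \<tau> / 2) * exp (- 2 * ((t - a) / \<tau>))) {a..b}"
proof -
  have "((\<lambda>s. (c + d * s - d * \<tau> / 2) * exp (- 2 * ((t - s) / \<tau>))) has_real_derivative
      (c + d * s) * (2 / \<tau>) * exp (- 2 * ((t - s) / \<tau>))) (at s within {a..b})" for s
    using \<tau> by (auto intro!: derivative_eq_intros simp: field_simps)
  then show ?thesis
    by (intro fundamental_theorem_of_calculus ab)
       (simp add: has_real_derivative_iff_has_vector_derivative)
qed

lemma inelastic_strain_ramp:
  assumes \<tau>: "\<tau> > 0" and t: "0 \<le> t"
    and ramp: "\<And>s. s \<in> {0..t} \<Longrightarrow> \<epsilon> s = \<eta> * s"
  shows "inelastic_strain \<tau> \<epsilon> t = \<eta> * t - \<tau> * \<eta> / 2 * (1 - exp (- (2 / \<tau>) * t))"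
proof -
  have int: "((\<lambda>s. \<epsilon> s * (2 / \<tau>) * exp (- 2 * ((t - s) / \<tau>))) has_integral
      (0 + \<eta> * t - \<eta> * \<tau> / 2) * exp (- 2 * ((t - t) / \<tau>))
      - (0 + \<eta> * 0 - \<eta> * \<tau> / 2) * exp (- 2 * ((t - 0) / \<tau>))) {0..t}"
    by (rule has_integral_eq[OF _ affine_kernel_integral[OF \<tau> t]]) (simp add: ramp)
  show ?thesis
    unfolding inelastic_strain_def integral_unique[OF int] by (simp add: algebra_simps)
qed

text \<open>The hold starts at time \<open>r\<close> with the strain \<open>\<eta> * r\<close> reached by the ramp. The resulting deviation
  from the held strain is the relaxation of what the ramp had built up, written as an
  exponential in absolute time.\<close>

lemma inelastic_strain_ramp_hold:
  assumes \<tau>: "\<tau> > 0" and r: "0 \<le> r" "r \<le> t"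
    and ramp: "\<And>s. s \<in> {0..r} \<Longrightarrow> \<epsilon> s = \<eta> * s"
    and hold: "\<And>s. s \<in> {r..t} \<Longrightarrow> \<epsilon> s = \<eta> * r"
  shows "inelastic_strain \<tau> \<epsilon> t
    = \<eta> * r + \<tau> * \<eta> / 2 * (1 - exp (2 * r / \<tau>)) * exp (- (2 / \<tau>) * t)"
proof -
  let ?f = "\<lambda>s. \<epsilon> s * (2 / \<tau>) * exp (- 2 * ((t - s) / \<tau>))"
  have 1: "(?f has_integral
      (0 + \<eta> * r - \<eta> * \<tau> / 2) * exp (- 2 * ((t - r) / \<tau>))
      - (0 + \<eta> * 0 - \<eta> * \<tau> / 2) * exp (- 2 * ((t - 0) / \<tau>))) {0..r}"
    by (rule has_integral_eq[OF _ affine_kernel_integral[OF \<tau> r(1)]]) (simp add: ramp)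
  have 2: "(?f has_integral
      (\<eta> * r + 0 * t - 0 * \<tau> / 2) * exp (- 2 * ((t - t) / \<tau>))
      - (\<eta> * r + 0 * r - 0 * \<tau> / 2) * exp (- 2 * ((t - r) / \<tau>))) {r..t}"
    by (rule has_integral_eq[OF _ affine_kernel_integral[OF \<tau> r(2)]]) (simp add: hold)
  have split_exp: "exp (- 2 * ((t - r) / \<tau>)) = exp (2 * r / \<tau>) * exp (- (2 / \<tau>) * t)"
    by (simp add: exp_add[symmetric] diff_divide_distrib algebra_simps)
  have abs_exp: "exp (- 2 * ((t - 0) / \<tau>)) = exp (- (2 / \<tau>) * t)"
    by simp
  show ?thesis
    using integral_unique[OF has_integral_combine[OF r 1 2]]
    unfolding inelastic_strain_def split_exp abs_exp by (simp add: algebra_simps)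
qed

theorem proposition3p2:
  fixes T \<eta> eps_max \<mu> :: real and n :: nat
    and m \<tau> :: "nat \<Rightarrow> real" and \<epsilon> :: "real \<Rightarrow> real"
  assumes "T > 0" and "\<eta> > 0" and "eps_max > 0" and "\<mu> \<ge> 0"
    and "\<And>j. j \<in> {1..n} \<Longrightarrow> m j \<ge> 0"
    and "\<And>j. j \<in> {1..n} \<Longrightarrow> \<tau> j > 0"
    and "\<And>t. t \<in> {0..T} \<Longrightarrow> \<epsilon> t = (if t \<le> eps_max / \<eta> then \<eta> * t else eps_max)"
  shows "\<forall>t\<in>{0..T}.
      (\<forall>j\<in>{1..n}. branch_stress \<mu> m \<tau> \<epsilon> j t =
        (if t \<le> eps_max / \<eta>
         then m j * \<tau> j * \<eta> / 2 * (1 - exp (- (2 / \<tau> j) * t))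
         else - (m j * \<tau> j * \<eta> / 2) * (1 - exp (2 * eps_max / (\<tau> j * \<eta>)))
                * exp (- (2 / \<tau> j) * t)))
    \<and> branch_stress \<mu> m \<tau> \<epsilon> 0 t =
        (if t \<le> eps_max / \<eta> then \<mu> * \<eta> * t else \<mu> * eps_max)
    \<and> total_stress n \<mu> m \<tau> \<epsilon> t = (\<Sum>j = 0..n. branch_stress \<mu> m \<tau> \<epsilon> j t)
    \<and> total_stress n \<mu> m \<tau> \<epsilon> t =
        (if t \<le> eps_max / \<eta>
         then \<mu> * \<eta> * t
              + (\<Sum>j = 1..n. m j * \<tau> j * \<eta> / 2 * (1 - exp (- (2 / \<tau> j) * t)))
         else \<mu> * eps_max
              - (\<Sum>j = 1..n. m j * \<tau> j * \<eta> / 2 * (1 - exp (2 * eps_max / (\<tau> j * \<eta>)))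
                                * exp (- (2 / \<tau> j) * t)))"
proof (rule ballI, goal_cases)
  case t: (1 t)
  note \<epsilon> = assms(7)
  let ?r = "eps_max / \<eta>"
  let ?ramp = "\<lambda>j. m j * \<tau> j * \<eta> / 2 * (1 - exp (- (2 / \<tau> j) * t))"
  let ?hold = "\<lambda>j. m j * \<tau> j * \<eta> / 2 * (1 - exp (2 * eps_max / (\<tau> j * \<eta>)))
    * exp (- (2 / \<tau> j) * t)"
  have r: "0 \<le> ?r" and \<eta>r: "\<eta> * ?r = eps_max"
    using assms by auto
  have maxwell: "maxwell_stress (m j) (\<tau> j) \<epsilon> t = (if t \<le> ?r then ?ramp j else - ?hold j)"
    if j: "j \<in> {1..n}" for j
  proof (cases "t \<le> ?r")
    case True
    have "inelastic_strain (\<tau> j) \<epsilon> t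
        = \<eta> * t - \<tau> j * \<eta> / 2 * (1 - exp (- (2 / \<tau> j) * t))"
      using t True by (intro inelastic_strain_ramp assms(6) j) (auto simp: \<epsilon>)
    then show ?thesis
      using True t by (simp add: maxwell_stress_def \<epsilon>)
  next
    case False
    \<comment> \<open>At the switching time itself the strain is given by the ramp, whose value there is
      \<open>eps_max\<close>.\<close>
    have hold: "\<epsilon> s = \<eta> * ?r" if "s \<in> {?r..t}" for s
    proof -
      have "s \<in> {0..T}"
        using that t r by auto
      moreover have "s = ?r" if "s \<le> ?r"
        using that \<open>s \<in> {?r..t}\<close> by simp
      ultimately show ?thesis
        using \<epsilon>[of s] \<eta>r by (cases "s \<le> ?r") auto
    qed
    have "inelastic_strain (\<tau> j) \<epsilon> t
        = \<eta> * ?r + \<tau> j * \<eta> / 2 * (1 - exp (2 * ?r / \<tau> j)) * exp (- (2 / \<tau> j) * t)"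
      using t False r by (intro inelastic_strain_ramp_hold assms(6) j hold) (auto simp: \<epsilon>)
    moreover have "2 * ?r / \<tau> j = 2 * eps_max / (\<tau> j * \<eta>)"
      by (simp add: mult.commute)
    moreover have "\<epsilon> t = eps_max"
      using False \<epsilon>[OF t] by simp
    ultimately show ?thesis
      using False \<eta>r by (simp only: maxwell_stress_def if_False) (simp add: algebra_simps)
  qed
  have spring: "\<mu> * \<epsilon> t = (if t \<le> ?r then \<mu> * \<eta> * t else \<mu> * eps_max)"
    using \<epsilon>[OF t] by simp
  have total: "total_stress n \<mu> m \<tau> \<epsilon> t
      = \<mu> * \<epsilon> t + (\<Sum>j = 1..n. maxwell_stress (m j) (\<tau> j) \<epsilon> t)"
    by (simp add: total_stress_def maxwell_stress_def)
  also have "(\<Sum>j = 1..n. maxwell_stress (m j) (\<tau> j) \<epsilon> t)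
      = (\<Sum>j = 1..n. if t \<le> ?r then ?ramp j else - ?hold j)"
    by (rule sum.cong[OF refl maxwell])
  finally have "total_stress n \<mu> m \<tau> \<epsilon> t
      = \<mu> * \<epsilon> t + (\<Sum>j = 1..n. if t \<le> ?r then ?ramp j else - ?hold j)" .
  then have closed: "total_stress n \<mu> m \<tau> \<epsilon> t
      = (if t \<le> ?r then \<mu> * \<eta> * t + (\<Sum>j = 1..n. ?ramp j)
         else \<mu> * eps_max - (\<Sum>j = 1..n. ?hold j))"
    unfolding spring by (cases "t \<le> ?r") (simp_all only: if_True if_False sum_negf diff_conv_add_uminus)
  have branches: "total_stress n \<mu> m \<tau> \<epsilon> t = (\<Sum>j = 0..n. branch_stress \<mu> m \<tau> \<epsilon> j t)"
    unfolding total
    by (simp add: sum.atLeast_Suc_atMost[of 0] branch_stress_def spring_stress_def)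
  have "\<forall>j\<in>{1..n}. branch_stress \<mu> m \<tau> \<epsilon> j t
      = (if t \<le> ?r then ?ramp j
         else - (m j * \<tau> j * \<eta> / 2) * (1 - exp (2 * eps_max / (\<tau> j * \<eta>)))
           * exp (- (2 / \<tau> j) * t))"
    using maxwell by (simp add: branch_stress_def)
  moreover have "branch_stress \<mu> m \<tau> \<epsilon> 0 t
      = (if t \<le> ?r then \<mu> * \<eta> * t else \<mu> * eps_max)"
    using spring by (simp add: branch_stress_def spring_stress_def)
  ultimately show ?case
    using branches closed by (intro conjI)
qed

end
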